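(* Let $G$ be a connected and locally path connected topological group with identity element $e_G$. Then $\pi_1^{qtop}(G,e_G)=\pi_1^{wh}(G,e_G)$ (that is, the two topologies on the group $\pi_1(G,e_G)$ coincide), and this is a topological group.
   Context: For a pointed space $(X,x_0)$, $\pi_1^{qtop}(X,x_0)$ denotes the fundamental group $\pi_1(X,x_0)$ with the quotient topology induced by the natural surjection $q:\Omega(X,x_0)\to\pi_1(X,x_0)$, $\alpha\mapsto[\alpha]$, where $\Omega(X,x_0)$ is the space of loops in $X$ based at $x_0$ with the compact-open topology. $\pi_1^{wh}(X,x_0)$ denotes $\pi_1(X,x_0)$ with the whisker topology, which has as a basis the collection of all sets $[\alpha]i_*\pi_1(U,x_0)=\{[\beta]\in\pi_1(X,x_0)\mid \beta\simeq\alpha*\delta \text{ rel } \{0,1\}\text{ for some loop }\delta:[0,1]\to U\text{ based at }x_0\}$, where $[\alpha]\in\pi_1(X,x_0)$ and $U$ is an open neighborhood of $x_0$ ($i:U\to X$ is the inclusion). *)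

theory Defs
  imports "HOL-Analysis.Analysis" "HOL-Algebra.Group"
begin

locale topological_group = group G for G (structure) and T :: "'a topology" +
  assumes topspace_eq_carrier: "topspace T = carrier G"
    and continuous_mult: "continuous_map (prod_topology T T) T (\<lambda>(x, y). x \<otimes> y)"
    and continuous_inv: "continuous_map T T (\<lambda>x. inv x)"

definition quotient_topology :: "'a topology \<Rightarrow> ('a \<Rightarrow> 'b) \<Rightarrow> 'b topology" where
  "quotient_topology X f =
     topology (\<lambda>U. U \<subseteq> f ` topspace X \<and> openin X {x \<in> topspace X. f x \<in> U})"

lemma openin_quotient_topology:
  "openin (quotient_topology X f) U \<longleftrightarrow>
     U \<subseteq> f ` topspace X \<and> openin X {x \<in> topspace X. f x \<in> U}"
proof -
  have "istopology (\<lambda>U. U \<subseteq> f ` topspace X \<and> openin X {x \<in> topspace X. f x \<in> U})"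
    unfolding istopology_def
  proof (rule conjI; intro allI impI)
    fix S T
    assume "S \<subseteq> f ` topspace X \<and> openin X {x \<in> topspace X. f x \<in> S}"
      and "T \<subseteq> f ` topspace X \<and> openin X {x \<in> topspace X. f x \<in> T}"
    moreover have "{x \<in> topspace X. f x \<in> S \<inter> T} =
        {x \<in> topspace X. f x \<in> S} \<inter> {x \<in> topspace X. f x \<in> T}" by blast
    ultimately show "S \<inter> T \<subseteq> f ` topspace X \<and> openin X {x \<in> topspace X. f x \<in> S \<inter> T}"
      by auto
  next
    fix \<K>
    assume *: "\<forall>K\<in>\<K>. K \<subseteq> f ` topspace X \<and> openin X {x \<in> topspace X. f x \<in> K}"
    have "{x \<in> topspace X. f x \<in> \<Union>\<K>} = (\<Union>K\<in>\<K>. {x \<in> topspace X. f x \<in> K})" by blast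
    with * show "\<Union>\<K> \<subseteq> f ` topspace X \<and> openin X {x \<in> topspace X. f x \<in> \<Union>\<K>}"
      by auto
  qed
  then show ?thesis
    by (simp add: quotient_topology_def topology_inverse')
qed

lemma quotient_map_quotient_topology: "quotient_map X (quotient_topology X f) f"
proof -
  have "{x \<in> topspace X. f x \<in> f ` topspace X} = topspace X" by blast
  then have "openin (quotient_topology X f) (f ` topspace X)"
    by (simp add: openin_quotient_topology)
  then have "topspace (quotient_topology X f) = f ` topspace X"
    by (metis openin_quotient_topology openin_subset openin_topspace subset_antisym)
  then show ?thesis
    by (auto simp: quotient_map_def openin_quotient_topology)
qed

text \<open>Continuous maps are represented by functions that are \<^const>\<open>undefined\<close> outside
  the domain space, so that equality of representatives is equality of maps.\<close>

definition compact_open_topology :: "'a topology \<Rightarrow> 'b topology \<Rightarrow> ('a \<Rightarrow> 'b) topology" where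
  "compact_open_topology X Y = topology_generated_by
     {{f \<in> extensional (topspace X). continuous_map X Y f \<and> f ` K \<subseteq> U} | K U.
        compactin X K \<and> openin Y U}"

lemma topspace_compact_open_topology:
  "topspace (compact_open_topology X Y) = {f \<in> extensional (topspace X). continuous_map X Y f}"
proof -
  have "{f \<in> extensional (topspace X). continuous_map X Y f \<and> f ` {} \<subseteq> {}} \<in>
     {{f \<in> extensional (topspace X). continuous_map X Y f \<and> f ` K \<subseteq> U} | K U.
        compactin X K \<and> openin Y U}"
    using compactin_empty openin_empty by blast
  then show ?thesis
    unfolding compact_open_topology_def topology_generated_by_topspace by auto
qed

definition loops :: "'a topology \<Rightarrow> 'a \<Rightarrow> (real \<Rightarrow> 'a) set" where
  "loops X x\<^sub>0 = {p \<in> extensional {0..1}. pathin X p \<and> p 0 = x\<^sub>0 \<and> p 1 = x\<^sub>0}"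

definition loop_space :: "'a topology \<Rightarrow> 'a \<Rightarrow> (real \<Rightarrow> 'a) topology" where
  "loop_space X x\<^sub>0 =
     subtopology (compact_open_topology (top_of_set {0..1}) X) (loops X x\<^sub>0)"

lemma topspace_loop_space: "topspace (loop_space X x\<^sub>0) = loops X x\<^sub>0"
  by (auto simp: loop_space_def loops_def topspace_compact_open_topology pathin_def)

definition const_loop :: "'a \<Rightarrow> real \<Rightarrow> 'a" where
  "const_loop x\<^sub>0 = (\<lambda>t\<in>{0..1}. x\<^sub>0)"

definition concat_loops :: "(real \<Rightarrow> 'a) \<Rightarrow> (real \<Rightarrow> 'a) \<Rightarrow> real \<Rightarrow> 'a" where
  "concat_loops p q = (\<lambda>t\<in>{0..1}. if t \<le> 1/2 then p (2 * t) else q (2 * t - 1))"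

definition loop_homotopic :: "'a topology \<Rightarrow> 'a \<Rightarrow> (real \<Rightarrow> 'a) \<Rightarrow> (real \<Rightarrow> 'a) \<Rightarrow> bool" where
  "loop_homotopic X x\<^sub>0 p q \<longleftrightarrow>
     homotopic_with (\<lambda>r. r 0 = x\<^sub>0 \<and> r 1 = x\<^sub>0) (top_of_set {0..1}) X p q"

definition loop_class :: "'a topology \<Rightarrow> 'a \<Rightarrow> (real \<Rightarrow> 'a) \<Rightarrow> (real \<Rightarrow> 'a) set" where
  "loop_class X x\<^sub>0 p = {q \<in> loops X x\<^sub>0. loop_homotopic X x\<^sub>0 p q}"

text \<open>The product is the union of the classes of all concatenations of representatives;
  these classes all coincide, so this union is the class of any one of them.\<close>

definition pi1 :: "'a topology \<Rightarrow> 'a \<Rightarrow> (real \<Rightarrow> 'a) set monoid" where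
  "pi1 X x\<^sub>0 =
     \<lparr>carrier = loop_class X x\<^sub>0 ` loops X x\<^sub>0,
      mult = (\<lambda>A B. \<Union>p\<in>A. \<Union>q\<in>B. loop_class X x\<^sub>0 (concat_loops p q)),
      one = loop_class X x\<^sub>0 (const_loop x\<^sub>0)\<rparr>"

definition pi1_qtop :: "'a topology \<Rightarrow> 'a \<Rightarrow> (real \<Rightarrow> 'a) set topology" where
  "pi1_qtop X x\<^sub>0 = quotient_topology (loop_space X x\<^sub>0) (loop_class X x\<^sub>0)"

definition whisker_nhd ::
    "'a topology \<Rightarrow> 'a \<Rightarrow> (real \<Rightarrow> 'a) \<Rightarrow> 'a set \<Rightarrow> (real \<Rightarrow> 'a) set set" where
  "whisker_nhd X x\<^sub>0 \<alpha> U =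
     {loop_class X x\<^sub>0 \<beta> | \<beta>. \<beta> \<in> loops X x\<^sub>0 \<and>
        (\<exists>\<delta> \<in> loops (subtopology X U) x\<^sub>0. loop_homotopic X x\<^sub>0 \<beta> (concat_loops \<alpha> \<delta>))}"

text \<open>If \<open>\<gamma>\<close> represents a point of the sets given by \<open>(\<alpha>, U)\<close> and \<open>(\<beta>, V)\<close>, then the set given
  by \<open>(\<gamma>, U \<inter> V)\<close> lies in both, so these sets are a basis of the topology they generate.\<close>

definition pi1_wh :: "'a topology \<Rightarrow> 'a \<Rightarrow> (real \<Rightarrow> 'a) set topology" where
  "pi1_wh X x\<^sub>0 = topology_generated_by
     {whisker_nhd X x\<^sub>0 \<alpha> U | \<alpha> U. \<alpha> \<in> loops X x\<^sub>0 \<and> openin X U \<and> x\<^sub>0 \<in> U}"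

end

theory Submission
  imports Defs
begin

text \<open>The multiplication of \<open>G\<close> turns the loops at \<open>\<one>\<close> into a group under pointwise multiplication,
  and by the Eckmann-Hilton argument (\<open>cls_concat\<close>, \<open>cls_pointwise_mult_commute\<close>) concatenation and
  pointwise multiplication, in either order of the factors, give homotopic loops. Hence
  \<open>\<pi>\<^sub>1(G)\<close> is an abelian quotient of the group of loops, and the whisker neighbourhoods of
  \<open>[\<alpha>]\<close> are the cosets \<open>[\<alpha>]H\<^sub>U\<close>, where \<open>H\<^sub>U\<close> is the subgroup of classes of loops in \<open>U\<close>.

  In any space the whisker topology refines the quotient topology: \<open>[\<alpha>]\<close> is also the class of
  \<open>\<alpha>\<close> followed by the constant loop, and replacing that constant part by a loop in a
  small neighbourhood \<open>U\<close> of the base point is a small change in the compact-open topology.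
  The converse uses the group. If \<open>\<gamma>\<close> is so close to \<open>\<beta>\<close> that \<open>\<beta>(t)\<inverse>\<gamma>(t) \<in> U\<close> for all
  \<open>t\<close>, then \<open>\<gamma>\<close> is the pointwise product of \<open>\<beta>\<close> and a loop in \<open>U\<close>, so \<open>[\<gamma>] \<in> [\<beta>]H\<^sub>U\<close>.
  Compactness of the interval makes the set of such \<open>\<gamma>\<close> open (\<open>openin_graph_in_open\<close>), hence cosets
  of \<open>H\<^sub>U\<close> are open in the quotient topology.

  The group operations are then continuous by looking at cosets: since \<open>\<pi>\<^sub>1(G)\<close> is abelian,
  \<open>[\<alpha>]H\<^sub>U [\<beta>]H\<^sub>U\<close> lies in \<open>[\<alpha>\<beta>]H\<^sub>U\<close>, and the inverses of the elements of \<open>[\<alpha>]H\<^sub>V\<close> lie in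
  \<open>[\<alpha>]\<inverse>H\<^sub>U\<close> for the neighbourhood \<open>V\<close> of the elements whose inverse is in \<open>U\<close>.\<close>

section \<open>Neighbourhoods in the compact-open topology\<close>

text \<open>For a constraint \<open>\<O>\<close> that varies with the point, a finite subcover by compact neighbourhoods \<open>K\<close>
  with \<open>K \<times> V \<subseteq> \<O>\<close> yields finitely many subbasic conditions \<open>f ` K \<subseteq> V\<close> that
  force the graph of \<open>f\<close> into \<open>\<O>\<close>. In a group this expresses uniform closeness of two loops.\<close>

lemma openin_graph_in_open:
  assumes cpt: "compact_space X" and reg: "Hausdorff_space X \<or> regular_space X"
    and \<O>: "openin (prod_topology X Y) \<O>"
  shows "openin (compact_open_topology X Y)
     {f \<in> topspace (compact_open_topology X Y). \<forall>x \<in> topspace X. (x, f x) \<in> \<O>}"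
    (is "openin ?C ?S")
proof (subst openin_subopen, intro ballI)
  fix f assume f: "f \<in> ?S"
  then have cf: "continuous_map X Y f"
    by (simp add: topspace_compact_open_topology)
  have nb: "neighbourhood_base_of (compactin X) X"
    using cpt reg compact_imp_locally_compact_space locally_compact_space_neighbourhood_base
    by blast
  have "\<exists>N K V. openin X N \<and> x \<in> N \<and> N \<subseteq> K \<and> compactin X K \<and> openin Y V \<and> f ` K \<subseteq> V \<and> K \<times> V \<subseteq> \<O>"
    if x: "x \<in> topspace X" for x
  proof -
    have "(x, f x) \<in> \<O>" using f x by blast
    then obtain I V where I: "openin X I" "openin Y V" "x \<in> I" "f x \<in> V" "I \<times> V \<subseteq> \<O>"
      using \<O> unfolding openin_prod_topology_alt by metis
    define W where "W = I \<inter> {y \<in> topspace X. f y \<in> V}"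
    have "openin X W \<and> x \<in> W"
      using I cf x by (simp add: W_def openin_Int openin_continuous_map_preimage)
    then obtain N K where "openin X N" "compactin X K" "x \<in> N" "N \<subseteq> K" "K \<subseteq> W"
      using nb unfolding neighbourhood_base_of by metis
    then show ?thesis
      using I by (intro exI[of _ N] exI[of _ K] exI[of _ V]) (auto simp: W_def)
  qed
  then obtain N K V where NKV: "\<And>x. x \<in> topspace X \<Longrightarrow> openin X (N x) \<and> x \<in> N x \<and> N x \<subseteq> K x \<and>
      compactin X (K x) \<and> openin Y (V x) \<and> f ` K x \<subseteq> V x \<and> K x \<times> V x \<subseteq> \<O>"
    by metis
  have "\<exists>\<F>. finite \<F> \<and> \<F> \<subseteq> N ` topspace X \<and> topspace X \<subseteq> \<Union>\<F>"
  proof -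
    have "\<forall>U \<in> N ` topspace X. openin X U" "topspace X \<subseteq> \<Union>(N ` topspace X)"
      using NKV by blast+
    then show ?thesis
      using cpt unfolding compact_space_def compactin_def by meson
  qed
  then obtain F where F: "finite F" "F \<subseteq> topspace X" "topspace X \<subseteq> (\<Union>x\<in>F. N x)"
    by (metis finite_subset_image)
  define B where "B x = {g \<in> extensional (topspace X). continuous_map X Y g \<and> g ` K x \<subseteq> V x}" for x
  have opB: "openin ?C (B x)" if "x \<in> F" for x
    unfolding compact_open_topology_def B_def
    by (rule topology_generated_by_Basis) (use that F NKV in blast)
  define A where "A = topspace ?C \<inter> (\<Inter>x\<in>F. B x)"
  have "openin ?C A"
  proof (cases "F = {}")
    case False
    then have "openin ?C (\<Inter>x\<in>F. B x)"
      using F opB by (intro openin_Inter) auto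
    then show ?thesis by (simp add: A_def openin_Int)
  qed (simp add: A_def)
  moreover have "f \<in> A"
  proof -
    have "f ` K x \<subseteq> V x" if "x \<in> F" for x
      using NKV F(2) that by blast
    then show ?thesis
      using f by (auto simp: A_def B_def topspace_compact_open_topology)
  qed
  moreover have "A \<subseteq> ?S"
  proof
    fix g assume g: "g \<in> A"
    have "(x, g x) \<in> \<O>" if x: "x \<in> topspace X" for x
    proof -
      obtain y where y: "y \<in> F" "x \<in> N y" using F x by blast
      then have "x \<in> K y" using NKV[of y] F by blast
      moreover have "g ` K y \<subseteq> V y" using g y by (simp add: A_def B_def)
      ultimately have "x \<in> K y" "g x \<in> V y" by auto
      moreover have "K y \<times> V y \<subseteq> \<O>" using NKV[of y] F y by blast
      ultimately show ?thesis by blast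
    qed
    then show "g \<in> ?S" using g by (simp add: A_def)
  qed
  ultimately show "\<exists>A. openin ?C A \<and> f \<in> A \<and> A \<subseteq> ?S" by blast
qed

section \<open>Loops, homotopy and reparametrisation\<close>

lemma loops_D:
  assumes "p \<in> loops X x"
  shows "continuous_map (top_of_set {0..1}) X p" "p 0 = x" "p 1 = x" "p \<in> extensional {0..1}"
    "t \<in> {0..1} \<Longrightarrow> p t \<in> topspace X" "x \<in> topspace X"
proof -
  show c: "continuous_map (top_of_set {0..1}) X p" and "p 0 = x" "p 1 = x" "p \<in> extensional {0..1}"
    using assms by (auto simp: loops_def pathin_def)
  show *: "t \<in> {0..1} \<Longrightarrow> p t \<in> topspace X" for t
    using continuous_map_funspace[OF c] by auto
  from *[of 0] \<open>p 0 = x\<close> show "x \<in> topspace X" by simp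
qed

lemma loops_I:
  assumes "continuous_map (top_of_set {0..1}) X p" "p 0 = x" "p 1 = x" "p \<in> extensional {0..1}"
  shows "p \<in> loops X x"
  using assms by (auto simp: loops_def pathin_def)

lemma loops_subtopology:
  "loops (subtopology X U) x = {p \<in> loops X x. p ` {0..1} \<subseteq> U}"
  by (auto simp: loops_def pathin_def continuous_map_in_subtopology)

lemma const_loop_in_loops: "x \<in> topspace X \<Longrightarrow> const_loop x \<in> loops X x"
  unfolding const_loop_def
  by (rule loops_I, rule continuous_map_eq[of _ _ "\<lambda>_. x"]) auto

lemma loop_homotopic_refl: "p \<in> loops X x \<Longrightarrow> loop_homotopic X x p p"
  by (simp add: loop_homotopic_def loops_D)

lemma loop_homotopic_sym: "loop_homotopic X x p q \<Longrightarrow> loop_homotopic X x q p"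
  unfolding loop_homotopic_def by (rule homotopic_with_symD)

lemma loop_homotopic_trans [trans]:
  "loop_homotopic X x p q \<Longrightarrow> loop_homotopic X x q r \<Longrightarrow> loop_homotopic X x p r"
  unfolding loop_homotopic_def by (rule homotopic_with_trans)

lemma loop_class_eq_iff:
  assumes "p \<in> loops X x" "q \<in> loops X x"
  shows "loop_class X x p = loop_class X x q \<longleftrightarrow> loop_homotopic X x p q"
  using assms unfolding loop_class_def
  by (blast intro: loop_homotopic_refl loop_homotopic_sym loop_homotopic_trans)

lemma mem_loop_class:
  "q \<in> loop_class X x p \<longleftrightarrow> q \<in> loops X x \<and> loop_homotopic X x p q"
  by (simp add: loop_class_def)

text \<open>The straight line from the identity to \<open>\<phi>\<close> stays in the convex set \<open>{0..1}\<close> and fixes both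
  endpoints. Prefixing or appending the constant loop is a reparametrisation of this kind.\<close>

lemma reparametrise_loop:
  assumes p: "p \<in> loops X x"
    and \<phi>: "continuous_on {0..1} \<phi>" "\<phi> ` {0..1} \<subseteq> {0..1}" "\<phi> 0 = 0" "\<phi> 1 = (1::real)"
  shows "(\<lambda>t\<in>{0..1}. p (\<phi> t)) \<in> loops X x"
    and "loop_homotopic X x p (\<lambda>t\<in>{0..1}. p (\<phi> t))"
proof -
  note cp = loops_D(1)[OF p]
  define k where "k = (\<lambda>(s::real, t). (1 - s) * t + s * \<phi> t)"
  have k01: "k (s, t) \<in> {0..1}" if "s \<in> {0..1}" "t \<in> {0..1}" for s t
  proof -
    have "\<phi> t \<in> {0..1}" using \<phi> that by blast
    then show ?thesis
      using convexD[OF convex_real_interval(5), of t 0 1 "\<phi> t" "1 - s" s] that by (simp add: k_def)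
  qed
  have "continuous_on ({0..1} \<times> {0..1}) k"
    unfolding k_def case_prod_unfold
    by (intro continuous_intros continuous_on_compose2[OF \<phi>(1)]) auto
  then have "continuous_map (prod_topology (top_of_set {0..1}) (top_of_set {0..1})) (top_of_set {0..1}) k"
    using k01 by (auto simp: continuous_map_in_subtopology)
  then have cont: "continuous_map (prod_topology (top_of_set {0..1}) (top_of_set {0..1})) X (p \<circ> k)"
    using cp by (rule continuous_map_compose)
  \<comment> \<open>The end stages of the homotopy must equal the two loops on the whole type, so outside
    \<open>{0..1}\<close> it takes the value \<open>undefined\<close>, like every extensional function.\<close>
  show "loop_homotopic X x p (\<lambda>t\<in>{0..1}. p (\<phi> t))"
    unfolding loop_homotopic_def homotopic_with_def
  proof (intro exI[of _ "\<lambda>(s, t). if t \<in> {0..1} then p (k (s, t)) else undefined"] conjI allI ballI)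
    show "continuous_map (prod_topology (top_of_set {0..1}) (top_of_set {0..1})) X
       (\<lambda>(s, t). if t \<in> {0..1} then p (k (s, t)) else undefined)"
      by (rule continuous_map_eq[OF cont]) auto
  qed (use loops_D[OF p] \<phi> in \<open>auto simp: k_def extensional_def\<close>)
  then have "continuous_map (top_of_set {0..1}) X (\<lambda>t\<in>{0..1}. p (\<phi> t))"
    unfolding loop_homotopic_def by (rule homotopic_with_imp_continuous_maps[THEN conjunct2])
  then show "(\<lambda>t\<in>{0..1}. p (\<phi> t)) \<in> loops X x"
    by (rule loops_I) (use loops_D[OF p] \<phi> in auto)
qed

lemma concat_const_right:
  assumes p: "p \<in> loops X x"
  shows "concat_loops p (const_loop x) \<in> loops X x"
    and "loop_homotopic X x p (concat_loops p (const_loop x))"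
proof -
  have "concat_loops p (const_loop x) = (\<lambda>t\<in>{0..1}. p (min (2 * t) 1))"
    using loops_D(2,3)[OF p] by (auto simp: concat_loops_def const_loop_def min_def fun_eq_iff)
  moreover have "continuous_on {0..1} (\<lambda>t::real. min (2 * t) 1)"
    by (intro continuous_intros)
  moreover have "(\<lambda>t::real. min (2 * t) 1) ` {0..1} \<subseteq> {0..1}"
    by auto
  ultimately show "concat_loops p (const_loop x) \<in> loops X x"
    and "loop_homotopic X x p (concat_loops p (const_loop x))"
    using reparametrise_loop[OF p, of "\<lambda>t. min (2 * t) 1"] by simp_all
qed

lemma concat_const_left:
  assumes p: "p \<in> loops X x"
  shows "concat_loops (const_loop x) p \<in> loops X x"
    and "loop_homotopic X x p (concat_loops (const_loop x) p)"
proof -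
  have "concat_loops (const_loop x) p = (\<lambda>t\<in>{0..1}. p (max (2 * t - 1) 0))"
    using loops_D(2,3)[OF p] by (auto simp: concat_loops_def const_loop_def max_def fun_eq_iff)
  moreover have "continuous_on {0..1} (\<lambda>t::real. max (2 * t - 1) 0)"
    by (intro continuous_intros)
  moreover have "(\<lambda>t::real. max (2 * t - 1) 0) ` {0..1} \<subseteq> {0..1}"
    by auto
  ultimately show "concat_loops (const_loop x) p \<in> loops X x"
    and "loop_homotopic X x p (concat_loops (const_loop x) p)"
    using reparametrise_loop[OF p, of "\<lambda>t. max (2 * t - 1) 0"] by simp_all
qed

lemma concat_loops_in_loops:
  assumes p: "p \<in> loops X x" and q: "q \<in> loops X x"
  shows "concat_loops p q \<in> loops X x"
proof -
  have half: "continuous_map (subtopology (top_of_set {0..1}) {t \<in> topspace (top_of_set {0..1}). t \<le> 1/2}) X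
      (p \<circ> (\<lambda>t. 2 * t))"
    by (rule continuous_map_compose[OF _ loops_D(1)[OF p]])
       (auto simp: continuous_map_in_subtopology subtopology_subtopology intro!: continuous_intros)
  have half': "continuous_map (subtopology (top_of_set {0..1}) {t \<in> topspace (top_of_set {0..1}). 1/2 \<le> t}) X
      (q \<circ> (\<lambda>t. 2 * t - 1))"
    by (rule continuous_map_compose[OF _ loops_D(1)[OF q]])
       (auto simp: continuous_map_in_subtopology subtopology_subtopology intro!: continuous_intros)
  have mid: "p (2 * t) = q (2 * t - 1)" if "t = 1/2" for t
    unfolding that using loops_D(3)[OF p] loops_D(2)[OF q] by simp
  have "continuous_map (top_of_set {0..1}) X
      (\<lambda>t. if t \<le> 1/2 then (p \<circ> (\<lambda>t. 2 * t)) t else (q \<circ> (\<lambda>t. 2 * t - 1)) t)"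
    by (rule continuous_map_cases_le[OF _ _ half half'])
       (use mid in \<open>auto\<close>)
  then have "continuous_map (top_of_set {0..1}) X (concat_loops p q)"
    by (rule continuous_map_eq) (auto simp: concat_loops_def)
  then show ?thesis
    by (rule loops_I) (use loops_D[OF p] loops_D[OF q] in \<open>auto simp: concat_loops_def\<close>)
qed

section \<open>The whisker topology refines the quotient topology\<close>

text \<open>It suffices to treat a subbasic set given by \<open>K\<close> and \<open>V\<close>. If \<open>K\<close> meets the second half of
  the interval, then the constant loop takes values in \<open>V\<close> there, so \<open>V\<close> is a neighbourhood of
  \<open>x\<close> and can serve as \<open>U\<close>; otherwise the concatenation agrees with \<open>\<alpha> * const\<close> on \<open>K\<close> for every \<open>\<delta>\<close>.\<close>

lemma concat_small_loop_in_open: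
  assumes \<alpha>: "\<alpha> \<in> loops X x"
    and \<O>: "openin (compact_open_topology (top_of_set {0..1}) X) \<O>"
    and mem: "concat_loops \<alpha> (const_loop x) \<in> \<O>"
  shows "\<exists>U. openin X U \<and> x \<in> U \<and> (\<forall>\<delta> \<in> loops (subtopology X U) x. concat_loops \<alpha> \<delta> \<in> \<O>)"
proof -
  have x: "x \<in> topspace X" using \<alpha> by (rule loops_D)
  from \<O> have "generate_topology_on
     {{f \<in> extensional (topspace (top_of_set {0..1})). continuous_map (top_of_set {0..1::real}) X f \<and> f ` K \<subseteq> U} | K U.
        compactin (top_of_set {0..1}) K \<and> openin X U} \<O>"
    by (simp add: compact_open_topology_def openin_topology_generated_by_iff)
  then show ?thesis
    using mem
  proof induction
    case (Int a b)
    then obtain U V where "openin X U" "x \<in> U" "\<forall>\<delta> \<in> loops (subtopology X U) x. concat_loops \<alpha> \<delta> \<in> a"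
      "openin X V" "x \<in> V" "\<forall>\<delta> \<in> loops (subtopology X V) x. concat_loops \<alpha> \<delta> \<in> b"
      by blast
    then show ?case
      by (intro exI[of _ "U \<inter> V"]) (auto simp: loops_subtopology)
  next
    case (UN \<K>)
    then show ?case by (meson Union_iff)
  next
    case (Basis s)
    then obtain K V where K: "compactin (top_of_set {0..1}) K" and V: "openin X V"
      and s: "s = {f \<in> extensional {0..1}. continuous_map (top_of_set {0..1}) X f \<and> f ` K \<subseteq> V}"
      by auto
    have K01: "K \<subseteq> {0..1}" using compactin_subset_topspace[OF K] by simp
    have im: "concat_loops \<alpha> (const_loop x) ` K \<subseteq> V" using Basis s by blast
    define U where "U = (if \<exists>t\<in>K. 1/2 < t then V else topspace X)"
    have "x \<in> U"
    proof (cases "\<exists>t\<in>K. 1/2 < t")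
      case True
      then obtain t where "t \<in> K" "1/2 < t" by blast
      then have "concat_loops \<alpha> (const_loop x) t = x"
        using K01 by (auto simp: concat_loops_def const_loop_def)
      then show ?thesis using im \<open>t \<in> K\<close> True by (auto simp: U_def)
    qed (simp add: U_def x)
    moreover have "openin X U" using V by (simp add: U_def)
    moreover have "concat_loops \<alpha> \<delta> \<in> s" if \<delta>: "\<delta> \<in> loops (subtopology X U) x" for \<delta>
    proof -
      have \<delta>': "\<delta> \<in> loops X x" "\<delta> ` {0..1} \<subseteq> U" using \<delta> by (auto simp: loops_subtopology)
      note l = loops_D[OF concat_loops_in_loops[OF \<alpha> \<delta>'(1)]]
      have "concat_loops \<alpha> \<delta> t \<in> V" if t: "t \<in> K" for t
      proof (cases "t \<le> 1/2")
        case True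
        then have "concat_loops \<alpha> \<delta> t = concat_loops \<alpha> (const_loop x) t"
          by (simp add: concat_loops_def)
        then show ?thesis using im t by auto
      next
        case False
        then have "U = V" using t by (auto simp: U_def)
        moreover have "concat_loops \<alpha> \<delta> t = \<delta> (2 * t - 1)" "2 * t - 1 \<in> {0..1}"
          using False t K01 by (auto simp: concat_loops_def)
        ultimately show ?thesis using \<delta>' by auto
      qed
      then show ?thesis using l s by auto
    qed
    ultimately show ?case by blast
  qed simp
qed

lemma topspace_pi1_qtop: "topspace (pi1_qtop X x) = loop_class X x ` loops X x"
  using quotient_imp_surjective_map[OF quotient_map_quotient_topology]
  by (metis pi1_qtop_def topspace_loop_space)

lemma openin_pi1_wh_whisker_nhd:
  "\<alpha> \<in> loops X x \<Longrightarrow> openin X U \<Longrightarrow> x \<in> U \<Longrightarrow> openin (pi1_wh X x) (whisker_nhd X x \<alpha> U)"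
  unfolding pi1_wh_def by (rule topology_generated_by_Basis) blast

lemma whisker_nhd_self:
  assumes "\<alpha> \<in> loops X x" "x \<in> U"
  shows "loop_class X x \<alpha> \<in> whisker_nhd X x \<alpha> U"
proof -
  have "const_loop x \<in> loops (subtopology X U) x"
    using assms loops_D(6)[OF assms(1)] by (simp add: const_loop_in_loops)
  then show ?thesis
    using assms concat_const_right[OF assms(1)] unfolding whisker_nhd_def by blast
qed

text \<open>This form of the comparison, for a chosen representative \<open>\<alpha>\<close>, is also what reduces continuity
  of the group operations to a computation with whisker neighbourhoods.\<close>

lemma whisker_nhd_subset_if_openin_pi1_qtop:
  assumes W: "openin (pi1_qtop X x) W" and \<alpha>: "\<alpha> \<in> loops X x" "loop_class X x \<alpha> \<in> W"
  obtains U where "openin X U" "x \<in> U" "whisker_nhd X x \<alpha> U \<subseteq> W"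
proof -
  have "openin (loop_space X x) {p \<in> loops X x. loop_class X x p \<in> W}"
    using W by (simp add: pi1_qtop_def openin_quotient_topology topspace_loop_space)
  then obtain \<O> where \<O>: "openin (compact_open_topology (top_of_set {0..1}) X) \<O>"
      and eq: "{p \<in> loops X x. loop_class X x p \<in> W} = \<O> \<inter> loops X x"
    unfolding loop_space_def openin_subtopology by blast
  have "loop_class X x (concat_loops \<alpha> (const_loop x)) = loop_class X x \<alpha>"
    using \<alpha> concat_const_right[OF \<alpha>(1)] by (metis loop_class_eq_iff)
  then have "concat_loops \<alpha> (const_loop x) \<in> \<O>"
    using \<alpha> concat_const_right[OF \<alpha>(1)] eq by (metis (no_types, lifting) IntD1 mem_Collect_eq)
  then obtain U where U: "openin X U" "x \<in> U"
      "\<forall>\<delta> \<in> loops (subtopology X U) x. concat_loops \<alpha> \<delta> \<in> \<O>"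
    using concat_small_loop_in_open[OF \<alpha>(1) \<O>] by blast
  have "whisker_nhd X x \<alpha> U \<subseteq> W"
  proof
    fix B assume "B \<in> whisker_nhd X x \<alpha> U"
    then obtain \<beta> \<delta> where b: "B = loop_class X x \<beta>" "\<beta> \<in> loops X x"
        "\<delta> \<in> loops (subtopology X U) x" "loop_homotopic X x \<beta> (concat_loops \<alpha> \<delta>)"
      unfolding whisker_nhd_def by blast
    have c: "concat_loops \<alpha> \<delta> \<in> loops X x"
      using b \<alpha> by (auto simp: loops_subtopology intro: concat_loops_in_loops)
    then have "concat_loops \<alpha> \<delta> \<in> {p \<in> loops X x. loop_class X x p \<in> W}"
      using U b eq by blast
    moreover have "B = loop_class X x (concat_loops \<alpha> \<delta>)"
      using b c by (simp add: loop_class_eq_iff)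
    ultimately show "B \<in> W" by simp
  qed
  then show thesis using U that by blast
qed

lemma openin_pi1_wh_if_openin_pi1_qtop:
  assumes W: "openin (pi1_qtop X x) W"
  shows "openin (pi1_wh X x) W"
proof (subst openin_subopen, intro ballI)
  fix A assume A: "A \<in> W"
  have "W \<subseteq> loop_class X x ` loops X x"
    using openin_subset[OF W] by (simp add: topspace_pi1_qtop)
  then obtain \<alpha> where \<alpha>: "\<alpha> \<in> loops X x" "A = loop_class X x \<alpha>"
    using A by blast
  then obtain U where U: "openin X U" "x \<in> U" "whisker_nhd X x \<alpha> U \<subseteq> W"
    using whisker_nhd_subset_if_openin_pi1_qtop[OF W] A by blast
  then show "\<exists>S. openin (pi1_wh X x) S \<and> A \<in> S \<and> S \<subseteq> W"
    using openin_pi1_wh_whisker_nhd[OF \<alpha>(1) U(1,2)] whisker_nhd_self[OF \<alpha>(1) U(2)] \<alpha>(2) by blast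
qed

section \<open>Pointwise multiplication of loops in a topological group\<close>

context topological_group
begin

definition pointwise_mult :: "(real \<Rightarrow> 'a) \<Rightarrow> (real \<Rightarrow> 'a) \<Rightarrow> real \<Rightarrow> 'a" where
  "pointwise_mult p q = (\<lambda>t\<in>{0..1}. p t \<otimes> q t)"

definition pointwise_inv :: "(real \<Rightarrow> 'a) \<Rightarrow> real \<Rightarrow> 'a" where
  "pointwise_inv p = (\<lambda>t\<in>{0..1}. inv (p t))"

abbreviation "L \<equiv> loops T \<one>"
abbreviation "cls \<equiv> loop_class T \<one>"

lemma continuous_map_mult:
  assumes "continuous_map X T f" "continuous_map X T g"
  shows "continuous_map X T (\<lambda>x. f x \<otimes> g x)"
proof -
  have "continuous_map X (prod_topology T T) (\<lambda>x. (f x, g x))"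
    using assms by (intro continuous_map_pairedI)
  from continuous_map_compose[OF this continuous_mult] show ?thesis
    by (simp add: o_def)
qed

lemma loops_carrier: "p \<in> L \<Longrightarrow> t \<in> {0..1} \<Longrightarrow> p t \<in> carrier G"
  using loops_D(5)[of p T \<one> t] by (simp add: topspace_eq_carrier)

lemma pointwise_mult_in_loops:
  assumes p: "p \<in> L" and q: "q \<in> L"
  shows "pointwise_mult p q \<in> L"
proof (rule loops_I)
  show "continuous_map (top_of_set {0..1}) T (pointwise_mult p q)"
    by (rule continuous_map_eq[OF continuous_map_mult[OF loops_D(1)[OF p] loops_D(1)[OF q]]])
       (simp add: pointwise_mult_def)
qed (use loops_D[OF p] loops_D[OF q] in \<open>auto simp: pointwise_mult_def\<close>)

lemma pointwise_inv_in_loops: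
  assumes p: "p \<in> L"
  shows "pointwise_inv p \<in> L"
proof (rule loops_I)
  show "continuous_map (top_of_set {0..1}) T (pointwise_inv p)"
    by (rule continuous_map_eq[OF continuous_map_compose[OF loops_D(1)[OF p] continuous_inv]])
       (simp add: pointwise_inv_def)
qed (use loops_D[OF p] in \<open>auto simp: pointwise_inv_def\<close>)

lemma const_loop_in_L: "const_loop \<one> \<in> L"
  by (simp add: const_loop_in_loops topspace_eq_carrier)

lemma pointwise_mult_assoc:
  "p \<in> L \<Longrightarrow> q \<in> L \<Longrightarrow> r \<in> L \<Longrightarrow>
   pointwise_mult (pointwise_mult p q) r = pointwise_mult p (pointwise_mult q r)"
  by (auto simp: pointwise_mult_def fun_eq_iff m_assoc loops_carrier)

lemma pointwise_mult_const_left: "p \<in> L \<Longrightarrow> pointwise_mult (const_loop \<one>) p = p"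
  using loops_D(4)[of p T \<one>]
  by (auto simp: pointwise_mult_def const_loop_def fun_eq_iff loops_carrier extensional_def)

lemma pointwise_inv_mult: "p \<in> L \<Longrightarrow> pointwise_mult (pointwise_inv p) p = const_loop \<one>"
  by (auto simp: pointwise_mult_def pointwise_inv_def const_loop_def fun_eq_iff loops_carrier)

lemma pointwise_mult_inv_cancel:
  "p \<in> L \<Longrightarrow> q \<in> L \<Longrightarrow> pointwise_mult p (pointwise_mult (pointwise_inv p) q) = q"
  using loops_D(4)[of q T \<one>]
  by (auto simp: pointwise_mult_def pointwise_inv_def fun_eq_iff loops_carrier extensional_def
      m_assoc[symmetric])

text \<open>The pointwise product of two homotopies is a homotopy, because multiplication is continuous and
  \<open>\<one> \<otimes> \<one> = \<one>\<close> keeps the endpoints fixed.\<close>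

lemma loop_homotopic_pointwise_mult:
  assumes "loop_homotopic T \<one> p p'" "loop_homotopic T \<one> q q'"
    and e: "p \<in> L" "p' \<in> L" "q \<in> L" "q' \<in> L"
  shows "loop_homotopic T \<one> (pointwise_mult p q) (pointwise_mult p' q')"
proof -
  let ?P = "prod_topology (top_of_set {0..1::real}) (top_of_set {0..1::real})"
  obtain h k where
    h: "continuous_map ?P T h" "\<And>t. h (0, t) = p t" "\<And>t. h (1, t) = p' t"
       "\<And>s. s \<in> {0..1} \<Longrightarrow> h (s, 0) = \<one> \<and> h (s, 1) = \<one>" and
    k: "continuous_map ?P T k" "\<And>t. k (0, t) = q t" "\<And>t. k (1, t) = q' t"
       "\<And>s. s \<in> {0..1} \<Longrightarrow> k (s, 0) = \<one> \<and> k (s, 1) = \<one>"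
    using assms(1,2) unfolding loop_homotopic_def homotopic_with_def by metis
  show ?thesis
    unfolding loop_homotopic_def homotopic_with_def
  proof (intro exI[of _ "\<lambda>(s, t). if t \<in> {0..1} then h (s, t) \<otimes> k (s, t) else undefined"] conjI allI ballI)
    show "continuous_map ?P T (\<lambda>(s, t). if t \<in> {0..1} then h (s, t) \<otimes> k (s, t) else undefined)"
      by (rule continuous_map_eq[OF continuous_map_mult[OF h(1) k(1)]]) auto
  qed (use h k in \<open>auto simp: pointwise_mult_def\<close>)
qed

lemma cls_pointwise_mult_cong:
  assumes "cls p = cls p'" "cls q = cls q'" "p \<in> L" "p' \<in> L" "q \<in> L" "q' \<in> L"
  shows "cls (pointwise_mult p q) = cls (pointwise_mult p' q')"
  using assms by (simp add: loop_class_eq_iff pointwise_mult_in_loops loop_homotopic_pointwise_mult)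

lemma cls_concat_const:
  assumes "p \<in> L"
  shows "cls (concat_loops p (const_loop \<one>)) = cls p" "cls (concat_loops (const_loop \<one>) p) = cls p"
  using assms concat_const_right[OF assms] concat_const_left[OF assms]
  by (metis loop_class_eq_iff)+

text \<open>The Eckmann-Hilton argument: on each half of the interval one of the two padded loops
  rests at \<open>\<one>\<close>, so their pointwise product is the concatenation itself.\<close>

lemma cls_concat:
  assumes p: "p \<in> L" and q: "q \<in> L"
  shows "cls (concat_loops p q) = cls (pointwise_mult p q)"
proof -
  have eq: "concat_loops p q =
      pointwise_mult (concat_loops p (const_loop \<one>)) (concat_loops (const_loop \<one>) q)"
    using p q by (auto simp: concat_loops_def pointwise_mult_def const_loop_def fun_eq_iff loops_carrier)
  show ?thesis
    unfolding eq
    using p q by (intro cls_pointwise_mult_cong cls_concat_const concat_const_right concat_const_left)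
qed

text \<open>Padding the two loops on the opposite sides makes the same pointwise product run
  through \<open>q\<close> first.\<close>

lemma cls_pointwise_mult_commute:
  assumes p: "p \<in> L" and q: "q \<in> L"
  shows "cls (pointwise_mult p q) = cls (pointwise_mult q p)"
proof -
  have "cls (pointwise_mult p q) =
      cls (pointwise_mult (concat_loops (const_loop \<one>) p) (concat_loops q (const_loop \<one>)))"
    using p q
    by (intro cls_pointwise_mult_cong cls_concat_const[symmetric] concat_const_right concat_const_left)
  also have "pointwise_mult (concat_loops (const_loop \<one>) p) (concat_loops q (const_loop \<one>))
      = concat_loops q p"
    using p q by (auto simp: concat_loops_def pointwise_mult_def const_loop_def fun_eq_iff loops_carrier)
  also have "cls \<dots> = cls (pointwise_mult q p)" using cls_concat p q by blast
  finally show ?thesis .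
qed

section \<open>The fundamental group as a quotient of the group of loops\<close>

lemma carrier_pi1: "carrier (pi1 T \<one>) = cls ` L"
  and one_pi1: "\<one>\<^bsub>pi1 T \<one>\<^esub> = cls (const_loop \<one>)"
  by (simp_all add: pi1_def)

text \<open>The union that defines the product in \<^const>\<open>pi1\<close> collapses, since all its members are the same
  class. With this formula the group laws of \<open>\<pi>\<^sub>1\<close> are inherited from pointwise multiplication, where
  they hold as equations of functions.\<close>

lemma mult_pi1:
  assumes p: "p \<in> L" and q: "q \<in> L"
  shows "cls p \<otimes>\<^bsub>pi1 T \<one>\<^esub> cls q = cls (pointwise_mult p q)"
proof -
  have "cls (concat_loops p' q') = cls (pointwise_mult p q)" if "p' \<in> cls p" "q' \<in> cls q" for p' q'
  proof -
    have "p' \<in> L" "q' \<in> L" "cls p' = cls p" "cls q' = cls q"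
      using that p q by (auto simp: mem_loop_class loop_class_eq_iff intro: loop_homotopic_sym)
    then show ?thesis using p q cls_concat cls_pointwise_mult_cong by metis
  qed
  moreover have "p \<in> cls p" "q \<in> cls q"
    using p q by (simp_all add: mem_loop_class loop_homotopic_refl)
  ultimately show ?thesis
    unfolding pi1_def by (simp, blast)
qed

lemma group_pi1: "group (pi1 T \<one>)"
proof (rule groupI)
  show "\<exists>y\<in>carrier (pi1 T \<one>). y \<otimes>\<^bsub>pi1 T \<one>\<^esub> x = \<one>\<^bsub>pi1 T \<one>\<^esub>" if x: "x \<in> carrier (pi1 T \<one>)" for x
  proof -
    obtain p where "p \<in> L" "x = cls p" using x by (auto simp: carrier_pi1)
    then show ?thesis
      by (intro bexI[of _ "cls (pointwise_inv p)"])
         (simp_all add: carrier_pi1 one_pi1 mult_pi1 pointwise_inv_in_loops pointwise_inv_mult)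
  qed
qed (auto simp: carrier_pi1 one_pi1 mult_pi1 pointwise_mult_in_loops const_loop_in_L
    pointwise_mult_assoc pointwise_mult_const_left)

lemma inv_pi1:
  assumes p: "p \<in> L"
  shows "inv\<^bsub>pi1 T \<one>\<^esub> cls p = cls (pointwise_inv p)"
  by (rule group.inv_equality[OF group_pi1])
     (use p in \<open>simp_all add: carrier_pi1 one_pi1 mult_pi1 pointwise_inv_in_loops pointwise_inv_mult\<close>)

section \<open>Whisker neighbourhoods as cosets\<close>

text \<open>The right-hand side is the coset of \<open>[\<alpha>]\<close> by the classes of loops in \<open>U\<close>, now written
  with the pointwise product, so that group calculations apply.\<close>

lemma whisker_nhd_eq:
  assumes \<alpha>: "\<alpha> \<in> L"
  shows "whisker_nhd T \<one> \<alpha> U = (\<lambda>\<delta>. cls (pointwise_mult \<alpha> \<delta>)) ` {\<delta> \<in> L. \<delta> ` {0..1} \<subseteq> U}"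
proof -
  have c: "cls (concat_loops \<alpha> \<delta>) = cls (pointwise_mult \<alpha> \<delta>)" "concat_loops \<alpha> \<delta> \<in> L"
    if "\<delta> \<in> L" for \<delta>
    by (rule cls_concat[OF \<alpha> that], rule concat_loops_in_loops[OF \<alpha> that])
  show ?thesis
  proof (intro equalityI subsetI)
    fix A assume "A \<in> whisker_nhd T \<one> \<alpha> U"
    then obtain \<beta> \<delta> where \<beta>: "A = cls \<beta>" "\<beta> \<in> L" and "\<delta> \<in> loops (subtopology T U) \<one>"
        and hom: "loop_homotopic T \<one> \<beta> (concat_loops \<alpha> \<delta>)"
      unfolding whisker_nhd_def by blast
    then have \<delta>: "\<delta> \<in> L" "\<delta> ` {0..1} \<subseteq> U"
      by (simp_all add: loops_subtopology)
    have "A = cls (concat_loops \<alpha> \<delta>)"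
      using \<beta> hom by (simp add: loop_class_eq_iff[OF \<beta>(2) c(2)[OF \<delta>(1)]])
    then show "A \<in> (\<lambda>\<delta>. cls (pointwise_mult \<alpha> \<delta>)) ` {\<delta> \<in> L. \<delta> ` {0..1} \<subseteq> U}"
      using c \<delta> by simp
  next
    fix A assume "A \<in> (\<lambda>\<delta>. cls (pointwise_mult \<alpha> \<delta>)) ` {\<delta> \<in> L. \<delta> ` {0..1} \<subseteq> U}"
    then obtain \<delta> where \<delta>: "\<delta> \<in> loops (subtopology T U) \<one>" and A: "A = cls (concat_loops \<alpha> \<delta>)"
      using c by (auto simp: loops_subtopology)
    have "concat_loops \<alpha> \<delta> \<in> L"
      using \<delta> c by (simp add: loops_subtopology)
    then show "A \<in> whisker_nhd T \<one> \<alpha> U"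
      unfolding whisker_nhd_def A mem_Collect_eq
      by (intro exI[of _ "concat_loops \<alpha> \<delta>"] conjI bexI[OF _ \<delta>] refl loop_homotopic_refl)
  qed
qed

text \<open>The condition says that the graph of \<open>\<beta>\<close> lies in the open set of pairs \<open>(t, y)\<close> with
  \<open>\<alpha>(t)\<inverse>y \<in> U\<close>.\<close>

lemma openin_loop_space_near:
  assumes \<alpha>: "\<alpha> \<in> L" and U: "openin T U"
  shows "openin (loop_space T \<one>) {\<beta> \<in> L. pointwise_mult (pointwise_inv \<alpha>) \<beta> ` {0..1} \<subseteq> U}"
proof -
  let ?I = "top_of_set {0..1::real}"
  define \<O> where "\<O> = {z \<in> topspace (prod_topology ?I T). pointwise_inv \<alpha> (fst z) \<otimes> snd z \<in> U}"
  have "continuous_map (prod_topology ?I T) T (\<lambda>z. (pointwise_inv \<alpha> \<circ> fst) z \<otimes> snd z)"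
    by (intro continuous_map_mult continuous_map_compose[OF continuous_map_fst]
        loops_D(1)[OF pointwise_inv_in_loops[OF \<alpha>]] continuous_map_snd)
  then have "openin (prod_topology ?I T) \<O>"
    unfolding \<O>_def comp_def using U by (rule openin_continuous_map_preimage)
  moreover have "compact_space ?I" by (simp add: compact_space_subtopology)
  moreover have "Hausdorff_space ?I" by (simp add: Hausdorff_space_subtopology)
  ultimately have "openin (compact_open_topology ?I T)
      {f \<in> topspace (compact_open_topology ?I T). \<forall>t \<in> topspace ?I. (t, f t) \<in> \<O>}"
    by (intro openin_graph_in_open) auto
  moreover have "{\<beta> \<in> L. pointwise_mult (pointwise_inv \<alpha>) \<beta> ` {0..1} \<subseteq> U} =
      {f \<in> topspace (compact_open_topology ?I T). \<forall>t \<in> topspace ?I. (t, f t) \<in> \<O>} \<inter> L"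
    by (auto simp: \<O>_def pointwise_mult_def topspace_compact_open_topology loops_D)
  ultimately show ?thesis
    unfolding loop_space_def openin_subtopology by blast
qed

text \<open>If \<open>[\<beta>] = [\<alpha>][\<delta>]\<close> lies in the coset, then so does the class of every \<open>\<gamma>\<close> that is close to \<open>\<beta>\<close>: it is
  \<open>\<beta>\<epsilon>\<close> for the loop \<open>\<epsilon> = \<beta>\<inverse>\<gamma>\<close> in \<open>U\<close>, so \<open>[\<gamma>] = [\<alpha>][\<delta>][\<epsilon>]\<close>.\<close>

lemma openin_pi1_qtop_whisker_nhd:
  assumes \<alpha>: "\<alpha> \<in> L" and U: "openin T U" "\<one> \<in> U"
  shows "openin (pi1_qtop T \<one>) (whisker_nhd T \<one> \<alpha> U)"
proof -
  let ?W = "whisker_nhd T \<one> \<alpha> U"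
  have sub: "?W \<subseteq> cls ` L"
    using \<alpha> by (auto simp: whisker_nhd_eq pointwise_mult_in_loops)
  have "openin (loop_space T \<one>) {\<beta> \<in> L. cls \<beta> \<in> ?W}"
  proof (subst openin_subopen, intro ballI)
    fix \<beta> assume "\<beta> \<in> {\<beta> \<in> L. cls \<beta> \<in> ?W}"
    then obtain \<delta> where \<beta>: "\<beta> \<in> L" and \<delta>: "\<delta> \<in> L" "\<delta> ` {0..1} \<subseteq> U"
        and eq: "cls \<beta> = cls (pointwise_mult \<alpha> \<delta>)"
      using \<alpha> by (auto simp: whisker_nhd_eq)
    define N where "N = {\<gamma> \<in> L. pointwise_mult (pointwise_inv \<beta>) \<gamma> ` {0..1} \<subseteq> U}"
    have "cls \<gamma> \<in> ?W" if \<gamma>: "\<gamma> \<in> N" for \<gamma>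
    proof -
      define \<epsilon> where "\<epsilon> = pointwise_mult (pointwise_inv \<beta>) \<gamma>"
      have \<epsilon>: "\<epsilon> \<in> L" "\<epsilon> ` {0..1} \<subseteq> U" and \<gamma>L: "\<gamma> \<in> L"
        using \<gamma> \<beta> by (auto simp: N_def \<epsilon>_def pointwise_mult_in_loops pointwise_inv_in_loops)
      have "cls \<gamma> = cls (pointwise_mult \<beta> \<epsilon>)"
        using \<beta> \<gamma>L by (simp add: \<epsilon>_def pointwise_mult_inv_cancel)
      also have "\<dots> = cls (pointwise_mult (pointwise_mult \<alpha> \<delta>) \<epsilon>)"
        using \<alpha> \<beta> \<delta> \<epsilon> eq by (intro cls_pointwise_mult_cong) (auto simp: pointwise_mult_in_loops)
      also have "\<dots> = cls (pointwise_mult \<alpha> (pointwise_mult \<delta> \<epsilon>))"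
        using \<alpha> \<delta> \<epsilon> by (simp add: pointwise_mult_assoc)
      \<comment> \<open>\<open>U\<close> need not be closed under multiplication, so the pointwise product of
        \<open>\<delta>\<close> and \<open>\<epsilon>\<close> may leave \<open>U\<close>; their concatenation does not.\<close>
      also have "\<dots> = cls (pointwise_mult \<alpha> (concat_loops \<delta> \<epsilon>))"
        using \<alpha> \<delta> \<epsilon>
        by (intro cls_pointwise_mult_cong cls_concat[symmetric] pointwise_mult_in_loops
            concat_loops_in_loops) auto
      finally have "cls \<gamma> = cls (pointwise_mult \<alpha> (concat_loops \<delta> \<epsilon>))" .
      moreover have "concat_loops \<delta> \<epsilon> \<in> L" using \<delta> \<epsilon> by (simp add: concat_loops_in_loops)
      moreover have "concat_loops \<delta> \<epsilon> ` {0..1} \<subseteq> U"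
        using \<delta> \<epsilon> by (auto simp: concat_loops_def image_subset_iff)
      ultimately show ?thesis unfolding whisker_nhd_eq[OF \<alpha>] by blast
    qed
    moreover have "\<beta> \<in> N"
      using \<beta> U by (auto simp: N_def pointwise_inv_mult const_loop_def)
    moreover have "openin (loop_space T \<one>) N"
      unfolding N_def using \<beta> U(1) by (rule openin_loop_space_near)
    moreover have "N \<subseteq> L" by (auto simp: N_def)
    ultimately show "\<exists>N. openin (loop_space T \<one>) N \<and> \<beta> \<in> N \<and> N \<subseteq> {\<beta> \<in> L. cls \<beta> \<in> ?W}"
      by blast
  qed
  then show ?thesis
    using sub by (simp add: pi1_qtop_def openin_quotient_topology topspace_loop_space)
qed

theorem pi1_qtop_eq_pi1_wh: "pi1_qtop T \<one> = pi1_wh T \<one>"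
proof (rule topology_eq[THEN iffD2], intro allI iffI)
  fix W assume "openin (pi1_wh T \<one>) W"
  then have "generate_topology_on
      {whisker_nhd T \<one> \<alpha> U | \<alpha> U. \<alpha> \<in> L \<and> openin T U \<and> \<one> \<in> U} W"
    by (simp add: pi1_wh_def openin_topology_generated_by_iff)
  then show "openin (pi1_qtop T \<one>) W"
    by (rule generate_topology_on_coarsest[OF istopology_openin, rotated])
       (auto intro: openin_pi1_qtop_whisker_nhd)
qed (rule openin_pi1_wh_if_openin_pi1_qtop)

section \<open>Continuity of the group operations\<close>

text \<open>Commutativity of \<open>\<pi>\<^sub>1\<close> moves \<open>\<beta>\<close> past the small loop \<open>\<delta>\<close>; as before, the two small
  loops are combined by concatenation in order to stay in \<open>U\<close>.\<close>

lemma mult_whisker_nhd_subset: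
  assumes \<alpha>: "\<alpha> \<in> L" and \<beta>: "\<beta> \<in> L"
    and A: "A \<in> whisker_nhd T \<one> \<alpha> U" and B: "B \<in> whisker_nhd T \<one> \<beta> U"
  shows "A \<otimes>\<^bsub>pi1 T \<one>\<^esub> B \<in> whisker_nhd T \<one> (pointwise_mult \<alpha> \<beta>) U"
proof -
  obtain \<delta> \<epsilon> where \<delta>: "\<delta> \<in> L" "\<delta> ` {0..1} \<subseteq> U" and \<epsilon>: "\<epsilon> \<in> L" "\<epsilon> ` {0..1} \<subseteq> U"
      and AB: "A = cls (pointwise_mult \<alpha> \<delta>)" "B = cls (pointwise_mult \<beta> \<epsilon>)"
    using A B \<alpha> \<beta> by (auto simp: whisker_nhd_eq)
  note L = \<alpha> \<beta> \<delta>(1) \<epsilon>(1) pointwise_mult_in_loops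
  have "A \<otimes>\<^bsub>pi1 T \<one>\<^esub> B = cls (pointwise_mult \<alpha> (pointwise_mult (pointwise_mult \<delta> \<beta>) \<epsilon>))"
    by (simp add: AB L mult_pi1 pointwise_mult_assoc)
  also have "\<dots> = cls (pointwise_mult \<alpha> (pointwise_mult (pointwise_mult \<beta> \<delta>) \<epsilon>))"
    by (intro cls_pointwise_mult_cong cls_pointwise_mult_commute refl L)
  also have "\<dots> = cls (pointwise_mult (pointwise_mult \<alpha> \<beta>) (pointwise_mult \<delta> \<epsilon>))"
    by (simp add: L pointwise_mult_assoc)
  also have "\<dots> = cls (pointwise_mult (pointwise_mult \<alpha> \<beta>) (concat_loops \<delta> \<epsilon>))"
    by (intro cls_pointwise_mult_cong cls_concat[symmetric] concat_loops_in_loops refl L)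
  finally have "A \<otimes>\<^bsub>pi1 T \<one>\<^esub> B = cls (pointwise_mult (pointwise_mult \<alpha> \<beta>) (concat_loops \<delta> \<epsilon>))" .
  moreover have "concat_loops \<delta> \<epsilon> \<in> L" using \<delta> \<epsilon> by (simp add: concat_loops_in_loops)
  moreover have "concat_loops \<delta> \<epsilon> ` {0..1} \<subseteq> U"
    using \<delta> \<epsilon> by (auto simp: concat_loops_def image_subset_iff)
  ultimately show ?thesis
    unfolding whisker_nhd_eq[OF pointwise_mult_in_loops[OF \<alpha> \<beta>]] by blast
qed

lemma inv_whisker_nhd_subset:
  assumes \<alpha>: "\<alpha> \<in> L" and A: "A \<in> whisker_nhd T \<one> \<alpha> {x \<in> topspace T. inv x \<in> U}"
  shows "inv\<^bsub>pi1 T \<one>\<^esub> A \<in> whisker_nhd T \<one> (pointwise_inv \<alpha>) U"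
proof -
  obtain \<delta> where \<delta>: "\<delta> \<in> L" "\<And>t. t \<in> {0..1} \<Longrightarrow> inv (\<delta> t) \<in> U"
      and A': "A = cls (pointwise_mult \<alpha> \<delta>)"
    using A \<alpha> by (auto simp: whisker_nhd_eq image_subset_iff)
  note L = \<alpha> \<delta>(1) pointwise_mult_in_loops pointwise_inv_in_loops
  have "inv\<^bsub>pi1 T \<one>\<^esub> A = cls (pointwise_inv (pointwise_mult \<alpha> \<delta>))"
    by (simp add: A' L inv_pi1)
  also have "pointwise_inv (pointwise_mult \<alpha> \<delta>) = pointwise_mult (pointwise_inv \<delta>) (pointwise_inv \<alpha>)"
    using \<alpha> \<delta>(1)
    by (auto simp: pointwise_inv_def pointwise_mult_def fun_eq_iff inv_mult_group loops_carrier)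
  also have "cls \<dots> = cls (pointwise_mult (pointwise_inv \<alpha>) (pointwise_inv \<delta>))"
    by (intro cls_pointwise_mult_commute L)
  finally have "inv\<^bsub>pi1 T \<one>\<^esub> A = cls (pointwise_mult (pointwise_inv \<alpha>) (pointwise_inv \<delta>))" .
  moreover have "pointwise_inv \<delta> \<in> L" "pointwise_inv \<delta> ` {0..1} \<subseteq> U"
    using \<delta> by (auto simp: pointwise_inv_in_loops) (simp add: pointwise_inv_def)
  ultimately show ?thesis
    unfolding whisker_nhd_eq[OF pointwise_inv_in_loops[OF \<alpha>]] by blast
qed

lemma topspace_pi1_qtop_eq_carrier: "topspace (pi1_qtop T \<one>) = carrier (pi1 T \<one>)"
  by (simp add: topspace_pi1_qtop carrier_pi1)

lemma continuous_map_pi1_mult: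
  "continuous_map (prod_topology (pi1_qtop T \<one>) (pi1_qtop T \<one>)) (pi1_qtop T \<one>)
     (\<lambda>(A, B). A \<otimes>\<^bsub>pi1 T \<one>\<^esub> B)"
  unfolding continuous_map_def
proof (intro conjI allI impI)
  let ?Q = "pi1_qtop T \<one>" and ?m = "\<lambda>(A, B). A \<otimes>\<^bsub>pi1 T \<one>\<^esub> B"
  show "?m \<in> topspace (prod_topology ?Q ?Q) \<rightarrow> topspace ?Q"
    by (auto simp: topspace_pi1_qtop mult_pi1 pointwise_mult_in_loops)
  fix W assume W: "openin ?Q W"
  show "openin (prod_topology ?Q ?Q) {z \<in> topspace (prod_topology ?Q ?Q). ?m z \<in> W}"
    unfolding openin_prod_topology_alt
  proof (intro allI impI)
    fix A B assume "(A, B) \<in> {z \<in> topspace (prod_topology ?Q ?Q). ?m z \<in> W}"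
    then obtain \<alpha> \<beta> where \<alpha>\<beta>: "\<alpha> \<in> L" "\<beta> \<in> L" "A = cls \<alpha>" "B = cls \<beta>"
        and "cls (pointwise_mult \<alpha> \<beta>) \<in> W"
      by (auto simp: topspace_pi1_qtop mult_pi1)
    then obtain U where U: "openin T U" "\<one> \<in> U" "whisker_nhd T \<one> (pointwise_mult \<alpha> \<beta>) U \<subseteq> W"
      using whisker_nhd_subset_if_openin_pi1_qtop[OF W] pointwise_mult_in_loops by blast
    let ?A = "whisker_nhd T \<one> \<alpha> U" and ?B = "whisker_nhd T \<one> \<beta> U"
    have op: "openin ?Q ?A" "openin ?Q ?B"
      using \<alpha>\<beta> U by (auto intro: openin_pi1_qtop_whisker_nhd)
    moreover have "A \<in> ?A" "B \<in> ?B"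
      using \<alpha>\<beta> U by (auto intro: whisker_nhd_self)
    moreover have "?A \<times> ?B \<subseteq> {z \<in> topspace (prod_topology ?Q ?Q). ?m z \<in> W}"
      using mult_whisker_nhd_subset[OF \<alpha>\<beta>(1,2), of _ U] U(3) openin_subset[OF op(1)] openin_subset[OF op(2)]
      by auto
    ultimately show "\<exists>U V. openin ?Q U \<and> openin ?Q V \<and> A \<in> U \<and> B \<in> V \<and>
        U \<times> V \<subseteq> {z \<in> topspace (prod_topology ?Q ?Q). ?m z \<in> W}"
      by blast
  qed
qed

lemma continuous_map_pi1_inv:
  "continuous_map (pi1_qtop T \<one>) (pi1_qtop T \<one>) (\<lambda>A. inv\<^bsub>pi1 T \<one>\<^esub> A)"
  unfolding continuous_map_def
proof (intro conjI allI impI)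
  let ?Q = "pi1_qtop T \<one>"
  show "(\<lambda>A. inv\<^bsub>pi1 T \<one>\<^esub> A) \<in> topspace ?Q \<rightarrow> topspace ?Q"
    by (auto simp: topspace_pi1_qtop inv_pi1 pointwise_inv_in_loops)
  fix W assume W: "openin ?Q W"
  show "openin ?Q {A \<in> topspace ?Q. inv\<^bsub>pi1 T \<one>\<^esub> A \<in> W}"
  proof (subst openin_subopen, intro ballI)
    fix A assume "A \<in> {A \<in> topspace ?Q. inv\<^bsub>pi1 T \<one>\<^esub> A \<in> W}"
    then obtain \<alpha> where \<alpha>: "\<alpha> \<in> L" "A = cls \<alpha>" and "cls (pointwise_inv \<alpha>) \<in> W"
      by (auto simp: topspace_pi1_qtop inv_pi1)
    then obtain U where U: "openin T U" "\<one> \<in> U" "whisker_nhd T \<one> (pointwise_inv \<alpha>) U \<subseteq> W"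
      using whisker_nhd_subset_if_openin_pi1_qtop[OF W] pointwise_inv_in_loops by blast
    let ?V = "{x \<in> topspace T. inv x \<in> U}"
    have V: "openin T ?V" "\<one> \<in> ?V"
      using U openin_continuous_map_preimage[OF continuous_inv] by (auto simp: topspace_eq_carrier)
    have op: "openin ?Q (whisker_nhd T \<one> \<alpha> ?V)"
      using \<alpha>(1) V by (rule openin_pi1_qtop_whisker_nhd)
    moreover have "A \<in> whisker_nhd T \<one> \<alpha> ?V"
      unfolding \<alpha>(2) using \<alpha>(1) V(2) by (rule whisker_nhd_self)
    moreover have "whisker_nhd T \<one> \<alpha> ?V \<subseteq> {A \<in> topspace ?Q. inv\<^bsub>pi1 T \<one>\<^esub> A \<in> W}"
      using inv_whisker_nhd_subset[OF \<alpha>(1), of _ U] U(3) openin_subset[OF op] by blast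
    ultimately show "\<exists>S. openin ?Q S \<and> A \<in> S \<and> S \<subseteq> {A \<in> topspace ?Q. inv\<^bsub>pi1 T \<one>\<^esub> A \<in> W}"
      by blast
  qed
qed

lemma topological_group_pi1_qtop: "topological_group (pi1 T \<one>) (pi1_qtop T \<one>)"
  by (intro topological_group.intro topological_group_axioms.intro group_pi1
      topspace_pi1_qtop_eq_carrier continuous_map_pi1_mult continuous_map_pi1_inv)

end

theorem corollary2p6:
  fixes G :: "('a, 'b) monoid_scheme" (structure) and T :: "'a topology"
  assumes "topological_group G T"
    and "connected_space T"
    and "locally_path_connected_space T"
  shows "pi1_qtop T \<one> = pi1_wh T \<one> \<and>
         topological_group (pi1 T \<one>) (pi1_qtop T \<one>)"
proof -
  interpret topological_group G T by fact
  show ?thesis using pi1_qtop_eq_pi1_wh topological_group_pi1_qtop by blast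
qed

end
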